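(* Let $k\ge 1$ be an integer, let $d=2^k$, and let $v\in\mathbb{C}^d$ be a unit vector. If the lines spanned by the vectors $Av$, $A\in G_k$, form a set of $d^2$ (distinct) equiangular lines in $\mathbb{C}^d$, then $k=1$ or $k=3$.
   Context: Let $X=\begin{pmatrix}0&1\\1&0\end{pmatrix}$, $Z=\begin{pmatrix}1&0\\0&-1\end{pmatrix}$, $Y=XZ$, and let $I$ be the $2\times2$ identity matrix. Define $G_k=\{I,X,Y,Z\}^{\otimes k}$, the set of all $4^k=d^2$ matrices $M_1\otimes\cdots\otimes M_k$ with each $M_i\in\{I,X,Y,Z\}$ (these are $d\times d$ matrices; they form a group modulo $-I$). A set of lines (one-dimensional subspaces) in $\mathbb{C}^d$ spanned by unit vectors $z_1,\dots,z_m$ is equiangular if there is a constant $a$ such that $|\langle z_i,z_j\rangle|=a$ for all $i\ne j$. *)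

theory Defs
  imports "Jordan_Normal_Form.VS_Connect"
begin

definition pauli_X :: "complex mat" where
  "pauli_X = mat_of_rows_list 2 [[0, 1], [1, 0]]"

definition pauli_Z :: "complex mat" where
  "pauli_Z = mat_of_rows_list 2 [[1, 0], [0, -1]]"

text \<open>This \<open>Y\<close> is the real matrix \<open>XZ\<close>, not the Hermitian Pauli matrix \<open>i XZ\<close>.\<close>

definition pauli_Y :: "complex mat" where
  "pauli_Y = pauli_X * pauli_Z"

definition kronecker_prod :: "complex mat \<Rightarrow> complex mat \<Rightarrow> complex mat" where
  "kronecker_prod A B =
     mat (dim_row A * dim_row B) (dim_col A * dim_col B)
       (\<lambda>(i, j). A $$ (i div dim_row B, j div dim_col B) * B $$ (i mod dim_row B, j mod dim_col B))"

text \<open>The set \<open>{I, X, Y, Z}\<^sup>\<otimes>\<^sup>k\<close>. The \<open>1 \<times> 1\<close> identity matrix, on which the fold ends,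
  is neutral for the Kronecker product.\<close>

definition pauli_tensors :: "nat \<Rightarrow> complex mat set" where
  "pauli_tensors k =
     {foldr kronecker_prod Ms (1\<^sub>m 1) | Ms.
        length Ms = k \<and> set Ms \<subseteq> {1\<^sub>m 2, pauli_X, pauli_Y, pauli_Z}}"

definition unit_vector :: "nat \<Rightarrow> complex vec \<Rightarrow> bool" where
  "unit_vector d z \<longleftrightarrow> z \<in> carrier_vec d \<and> z \<bullet>c z = 1"

definition line_of :: "nat \<Rightarrow> complex vec \<Rightarrow> complex vec set" where
  "line_of d z = LinearCombinations.module.span class_ring (module_vec TYPE(complex) d) {z}"

text \<open>A unit vector spanning a given line is determined up to a factor of modulus 1, so it makes no
  difference that the condition below ranges over all spanning unit vectors.\<close>

definition equiangular_lines :: "nat \<Rightarrow> complex vec set set \<Rightarrow> bool" where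
  "equiangular_lines d L \<longleftrightarrow>
     (\<forall>l\<in>L. \<exists>z. unit_vector d z \<and> l = line_of d z) \<and>
     (\<exists>a::real. \<forall>z w. unit_vector d z \<and> unit_vector d w \<and>
        line_of d z \<in> L \<and> line_of d w \<in> L \<and> line_of d z \<noteq> line_of d w \<longrightarrow>
        cmod (z \<bullet>c w) = a)"

end

theory Submission
  imports Defs
begin

unbundle bit_operations_syntax

text \<open>
  The elements of \<open>G\<^sub>k\<close> are, for bit vectors \<open>b\<close> and \<open>c\<close>, the matrices
  \<open>W\<^sub>c\<^sub>b = X\<^sup>c Z\<^sup>b\<close>. Put \<open>g c b = \<langle>W\<^sub>c\<^sub>b v, v\<rangle>\<close>. For a fixed \<open>c\<close>, \<open>g c\<close> is the
  Walsh transform of \<open>x \<mapsto> v\<^sub>x cnj v\<^sub>c\<^sub>+\<^sub>x\<close>. Parseval forces the common angle to be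
  \<open>1 / s\<close> with \<open>s\<^sup>2 = d + 1\<close>, and since every \<open>W\<^sub>c\<^sub>b\<close> is real and either symmetric or skew,
  each \<open>s g c b\<close> with \<open>(c, b) \<noteq> 0\<close> lies in \<open>{\<plusminus>1, \<plusminus>i}\<close>. Inverting the transform,
  \<open>s (d |v\<^sub>x|\<^sup>2 - 1)\<close> is an integer \<open>n\<^sub>x\<close>, and \<open>s d v\<^sub>x cnj v\<^sub>y\<close> is a Gaussian integer for
  \<open>x \<noteq> y\<close>. Taking its squared modulus, \<open>(s + n\<^sub>x) (s + n\<^sub>y)\<close> is an integer, so
  \<open>n\<^sub>x + n\<^sub>y = 0\<close> if \<open>s\<close> is irrational. With three coordinates available this gives
  \<open>n\<^sub>x = 0\<close> for all \<open>x\<close>, whence \<open>g 0 b = 0\<close> for \<open>b \<noteq> 0\<close>, a contradiction. Therefore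
  \<open>d = 2\<close> or \<open>2\<^sup>k + 1\<close> is a perfect square, that is \<open>k = 3\<close>.
\<close>

section \<open>Walsh characters: naturals below \<open>2 ^ k\<close> as bit vectors,
  \<open>XOR\<close> as addition\<close>

definition walsh :: "nat \<Rightarrow> nat \<Rightarrow> nat \<Rightarrow> complex" where
  "walsh k b j = (\<Prod>n<k. if bit b n \<and> bit j n then -1 else 1)"

lemma walsh_cases: "walsh k b j = 1 \<or> walsh k b j = -1"
  unfolding walsh_def by (induction k) (auto simp: lessThan_Suc)

lemma cnj_walsh [simp]: "cnj (walsh k b j) = walsh k b j"
  using walsh_cases[of k b j] by auto

lemma norm_walsh [simp]: "cmod (walsh k b j) = 1"
  using walsh_cases[of k b j] by auto

lemma walsh_0_left [simp]: "walsh k 0 j = 1"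
  by (simp add: walsh_def)

lemma walsh_0_right [simp]: "walsh k b 0 = 1"
  by (simp add: walsh_def)

lemma walsh_commute: "walsh k b j = walsh k j b"
  unfolding walsh_def by (rule prod.cong) auto

lemma walsh_xor_right: "walsh k b (i XOR j) = walsh k b i * walsh k b j"
  unfolding walsh_def prod.distrib[symmetric] by (rule prod.cong) (auto simp: bit_xor_iff)

lemma walsh_xor_left: "walsh k (a XOR b) j = walsh k a j * walsh k b j"
  using walsh_xor_right walsh_commute by metis

lemma walsh_Suc:
  "walsh (Suc k) b j =
     (if bit b k \<and> bit j k then -1 else 1) * walsh k (b mod 2 ^ k) (j mod 2 ^ k)"
proof -
  have "walsh k b j = walsh k (b mod 2 ^ k) (j mod 2 ^ k)"
    unfolding walsh_def
    by (rule prod.cong) (auto simp: take_bit_eq_mod[symmetric] bit_take_bit_iff)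
  then show ?thesis
    by (simp add: walsh_def)
qed

lemma walsh_power_right:
  assumes "n < k"
  shows "walsh k b (2 ^ n) = (if bit b n then -1 else 1)"
proof -
  have "walsh k b (2 ^ n) = (\<Prod>m<k. if m = n then (if bit b n then -1 else 1) else 1)"
    unfolding walsh_def by (rule prod.cong) (auto simp: bit_exp_iff)
  then show ?thesis
    using assms by simp
qed

lemma ex_bit_less:
  fixes b :: nat
  assumes "b < 2 ^ k" "b \<noteq> 0"
  obtains n where "n < k" "bit b n"
proof -
  obtain n where n: "bit b n"
    using assms(2) by (metis bit_eq_iff bit_0_eq bot_apply bot_bool_def)
  have "n < k"
    using assms(1) n by (metis bit_take_bit_iff take_bit_nat_eq_self)
  with n show thesis
    using that by blast
qed

lemma xor_less_power:
  fixes i j :: nat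
  assumes "i < 2 ^ k" "j < 2 ^ k"
  shows "i XOR j < 2 ^ k"
  using assms by (metis take_bit_nat_eq_self take_bit_nat_less_exp take_bit_xor)

lemma xor_cancel_left [simp]: "(c :: nat) XOR (c XOR j) = j"
  by (simp add: xor.assoc[symmetric])

lemma xor_cancel_right [simp]: "(j XOR c) XOR (c :: nat) = j"
  by (simp add: xor.assoc)

lemma xor_eq_zero_iff: "(i :: nat) XOR j = 0 \<longleftrightarrow> i = j"
  by (metis xor_cancel_right xor_self_eq xor.left_neutral)

lemma sum_xor_reindex:
  fixes f :: "nat \<Rightarrow> 'a :: comm_monoid_add"
  assumes "c < 2 ^ k"
  shows "(\<Sum>j<2 ^ k. f (c XOR j)) = (\<Sum>j<2 ^ k. f j)"
  using assms
  by (intro sum.reindex_bij_witness[where i = "\<lambda>j. c XOR j" and j = "\<lambda>j. c XOR j"])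
     (auto simp: xor_less_power)

text \<open>If bit \<open>n\<close> of \<open>j\<close> is set, translating \<open>b\<close> by
  \<open>2 ^ n\<close> flips the sign of every term, so the sum equals its own negative.\<close>

lemma sum_walsh:
  assumes "j < 2 ^ k"
  shows "(\<Sum>b<2 ^ k. walsh k b j) = (if j = 0 then 2 ^ k else 0)"
proof (cases "j = 0")
  case False
  obtain n where n: "n < k" "bit j n"
    using ex_bit_less[OF assms False] .
  have "(\<Sum>b<2 ^ k. walsh k b j) = (\<Sum>b<2 ^ k. walsh k (2 ^ n XOR b) j)"
    using n by (intro sum_xor_reindex[symmetric]) simp
  also have "\<dots> = - (\<Sum>b<2 ^ k. walsh k b j)"
    using n by (simp add: walsh_xor_left walsh_commute[of k "2 ^ n"] walsh_power_right sum_negf)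
  finally show ?thesis
    using False by simp
qed simp

lemma walsh_orthogonal:
  assumes "i < 2 ^ k" "j < 2 ^ k"
  shows "(\<Sum>b<2 ^ k. walsh k b i * walsh k b j) = (if i = j then 2 ^ k else 0)"
  using sum_walsh[OF xor_less_power[OF assms]]
  by (simp add: walsh_xor_right xor_eq_zero_iff)

section \<open>Pauli tensors as signed translations of bit vectors\<close>

definition pauli_mat :: "nat \<Rightarrow> nat \<Rightarrow> nat \<Rightarrow> complex mat" where
  "pauli_mat k c b =
     mat (2 ^ k) (2 ^ k) (\<lambda>(i, j). if i = c XOR j then walsh k b j else 0)"

lemma pauli_mat_carrier [simp]: "pauli_mat k c b \<in> carrier_mat (2 ^ k) (2 ^ k)"
  by (simp add: pauli_mat_def)

lemma pauli_Y_entries: "pauli_Y = mat_of_rows_list 2 [[0, -1], [1, 0]]"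
proof -
  have "{0..<2 :: nat} = {0, 1}"
    by auto
  note simps = mat_of_rows_list_def less_2_cases_iff less_Suc_eq scalar_prod_def this
  show ?thesis
    unfolding pauli_Y_def pauli_X_def pauli_Z_def by (rule eq_matI) (auto simp: simps)
qed

lemma pauli_mat_1:
  "pauli_mat 1 0 0 = 1\<^sub>m 2" "pauli_mat 1 1 0 = pauli_X"
  "pauli_mat 1 0 1 = pauli_Z" "pauli_mat 1 1 1 = pauli_Y"
proof -
  note simps = pauli_mat_def walsh_def less_2_cases_iff less_Suc_eq bit_0 mat_of_rows_list_def
  show "pauli_mat 1 0 0 = 1\<^sub>m 2"
    by (rule eq_matI) (auto simp: simps)
  show "pauli_mat 1 1 0 = pauli_X"
    by (rule eq_matI) (auto simp: simps pauli_X_def)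
  show "pauli_mat 1 0 1 = pauli_Z"
    by (rule eq_matI) (auto simp: simps pauli_Z_def)
  show "pauli_mat 1 1 1 = pauli_Y"
    by (rule eq_matI) (auto simp: simps pauli_Y_entries)
qed

lemma pauli_mat_1_mem:
  assumes "c < 2" "b < 2"
  shows "pauli_mat 1 c b \<in> {1\<^sub>m 2, pauli_X, pauli_Y, pauli_Z}"
  using assms pauli_mat_1 by (auto simp: less_2_cases_iff)

lemma nat_eq_iff_div_mod: "(i :: nat) = j \<longleftrightarrow> i div m = j div m \<and> i mod m = j mod m"
  by (metis div_mult_mod_eq)

text \<open>Kronecker indices split into quotient and remainder by \<open>2 ^ k\<close>, so the
  leftmost tensor factor is governed by the top bits of \<open>c\<close> and \<open>b\<close>. Both
  \<open>XOR\<close> and the Walsh sign respect this splitting.\<close>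

lemma pauli_mat_Suc:
  "pauli_mat (Suc k) c b =
     kronecker_prod (pauli_mat 1 (c div 2 ^ k) (b div 2 ^ k))
       (pauli_mat k (c mod 2 ^ k) (b mod 2 ^ k))"
  (is "?L = ?R")
proof (rule eq_matI)
  fix i j assume "i < dim_row ?R" "j < dim_col ?R"
  then have ij: "i < 2 * 2 ^ k" "j < 2 * 2 ^ k"
    by (simp_all add: kronecker_prod_def pauli_mat_def)
  then have "i div 2 ^ k < 2" "j div 2 ^ k < 2"
    by (simp_all add: less_mult_imp_div_less)
  moreover have "i = c XOR j \<longleftrightarrow>
      i div 2 ^ k = (c div 2 ^ k) XOR (j div 2 ^ k) \<and> i mod 2 ^ k = (c mod 2 ^ k) XOR (j mod 2 ^ k)"
    by (subst nat_eq_iff_div_mod[where m = "2 ^ k"])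
       (simp add: drop_bit_eq_div[symmetric] take_bit_eq_mod[symmetric])
  moreover have "walsh 1 (b div 2 ^ k) (j div 2 ^ k) = (if bit b k \<and> bit j k then -1 else 1)"
    by (simp add: walsh_def bit_iff_odd)
  ultimately show "?L $$ (i, j) = ?R $$ (i, j)"
    using ij by (auto simp: kronecker_prod_def pauli_mat_def walsh_Suc)
qed (simp_all add: kronecker_prod_def pauli_mat_def)

lemma pauli_mat_mem:
  assumes "c < 2 ^ k" "b < 2 ^ k"
  shows "pauli_mat k c b \<in> pauli_tensors k"
  using assms
proof (induction k arbitrary: c b)
  case 0
  have "pauli_mat 0 0 0 = 1\<^sub>m 1"
    by (rule eq_matI) (auto simp: pauli_mat_def)
  then show ?case
    using 0 by (auto simp: pauli_tensors_def)
next
  case (Suc k)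
  obtain Ms where Ms: "length Ms = k" "set Ms \<subseteq> {1\<^sub>m 2, pauli_X, pauli_Y, pauli_Z}"
    "pauli_mat k (c mod 2 ^ k) (b mod 2 ^ k) = foldr kronecker_prod Ms (1\<^sub>m 1)"
    using Suc.IH[of "c mod 2 ^ k" "b mod 2 ^ k"] by (auto simp: pauli_tensors_def)
  have M: "pauli_mat 1 (c div 2 ^ k) (b div 2 ^ k) \<in> {1\<^sub>m 2, pauli_X, pauli_Y, pauli_Z}"
    using Suc.prems by (intro pauli_mat_1_mem) (simp_all add: less_mult_imp_div_less)
  show ?case
    unfolding pauli_tensors_def
  proof (rule CollectI, intro exI conjI)
    show "pauli_mat (Suc k) c b =
        foldr kronecker_prod (pauli_mat 1 (c div 2 ^ k) (b div 2 ^ k) # Ms) (1\<^sub>m 1)"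
      using Ms(3) by (subst pauli_mat_Suc) simp
  qed (use Ms(1,2) M in auto)
qed

text \<open>The upper bound forces injectivity later: \<open>d\<^sup>2\<close> distinct lines
  arising from at most \<open>d\<^sup>2\<close> matrices means that different matrices give
  different lines.\<close>

lemma pauli_tensors_finite_card:
  "finite (pauli_tensors k)" "card (pauli_tensors k) \<le> (2 ^ k)\<^sup>2"
proof -
  let ?P = "{1\<^sub>m 2, pauli_X, pauli_Y, pauli_Z}"
  let ?L = "{Ms. set Ms \<subseteq> ?P \<and> length Ms = k}"
  have eq: "pauli_tensors k = (\<lambda>Ms. foldr kronecker_prod Ms (1\<^sub>m 1)) ` ?L"
    by (auto simp: pauli_tensors_def)
  have fin: "finite ?L"
    by (intro finite_lists_length_eq) simp
  then show "finite (pauli_tensors k)"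
    by (simp add: eq)
  have "card ?P \<le> 4"
    by (auto simp: card_insert_if)
  have "card (pauli_tensors k) \<le> card ?L"
    unfolding eq by (rule card_image_le[OF fin])
  also have "\<dots> = card ?P ^ k"
    by (intro card_lists_length_eq) simp
  also have "\<dots> \<le> 4 ^ k"
    using \<open>card ?P \<le> 4\<close> by (rule power_mono) simp
  also have "\<dots> = (2 ^ k)\<^sup>2"
    by (simp add: power_mult power2_eq_square flip: power_mult_distrib)
  finally show "card (pauli_tensors k) \<le> (2 ^ k)\<^sup>2" .
qed

lemma pauli_mat_0_0: "pauli_mat k 0 0 = 1\<^sub>m (2 ^ k)"
  by (rule eq_matI) (auto simp: pauli_mat_def)

text \<open>Entry \<open>(0, 0)\<close> detects a nonzero translation \<open>c\<close>, and the
  diagonal entry at \<open>2 ^ n\<close> detects bit \<open>n\<close> of \<open>b\<close>. This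
  guarantees that \<open>(c, b) \<noteq> (0, 0)\<close> yields a line other than that of
  \<open>v\<close>.\<close>

lemma pauli_mat_eq_one_iff:
  assumes "c < 2 ^ k" "b < 2 ^ k"
  shows "pauli_mat k c b = 1\<^sub>m (2 ^ k) \<longleftrightarrow> c = 0 \<and> b = 0"
proof (intro iffI)
  assume one: "pauli_mat k c b = 1\<^sub>m (2 ^ k)"
  have entry: "pauli_mat k c b $$ (i, j) = (if i = j then 1 else 0)"
    if "i < 2 ^ k" "j < 2 ^ k" for i j
    unfolding one using that by simp
  have c: "c = 0"
    using entry[of 0 0] by (auto simp: pauli_mat_def split: if_splits)
  have "b = 0"
  proof (rule ccontr)
    assume "b \<noteq> 0"
    then obtain n where n: "n < k" "bit b n"
      using ex_bit_less assms(2) by blast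
    then show False
      using entry[of "2 ^ n" "2 ^ n"] c walsh_power_right[of n k b] by (simp add: pauli_mat_def)
  qed
  with c show "c = 0 \<and> b = 0" ..
qed (simp add: pauli_mat_0_0)

lemma pauli_mat_mult_vec:
  assumes "v \<in> carrier_vec (2 ^ k)" "c < 2 ^ k" "i < 2 ^ k"
  shows "(pauli_mat k c b *\<^sub>v v) $ i = walsh k b (c XOR i) * v $ (c XOR i)"
proof -
  have "i = c XOR j \<longleftrightarrow> j = c XOR i" for j
    by auto
  then have "(pauli_mat k c b *\<^sub>v v) $ i =
      (\<Sum>j\<in>{0..<2 ^ k}. (if j = c XOR i then walsh k b j else 0) * v $ j)"
    using assms by (simp add: pauli_mat_def scalar_prod_def)
  also have "\<dots> = (\<Sum>j\<in>{0..<2 ^ k}. if j = c XOR i then walsh k b j * v $ j else 0)"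
    by (rule sum.cong) auto
  finally show ?thesis
    using xor_less_power[OF assms(2,3)] by simp
qed

section \<open>Overlaps with \<open>v\<close> as Walsh transforms\<close>

lemma of_real_power_mult_norm_sq:
  "complex_of_real (2 ^ k * (cmod z)\<^sup>2) = 2 ^ k * (z * cnj z)"
  by (simp add: complex_norm_square del: of_real_power) simp

text \<open>This is \<open>g c b\<close> of the overview, written directly as a Walsh sum so that
  Fourier inversion and Parseval apply in \<open>b\<close> for each fixed \<open>c\<close>;
  \<open>pauli_mat_inner\<close> identifies it with the inner product.\<close>

definition overlap :: "nat \<Rightarrow> complex vec \<Rightarrow> nat \<Rightarrow> nat \<Rightarrow> complex" where
  "overlap k v c b = (\<Sum>j<2 ^ k. walsh k b j * (v $ j * cnj (v $ (c XOR j))))"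

lemma pauli_mat_inner:
  assumes "v \<in> carrier_vec (2 ^ k)" "c < 2 ^ k"
  shows "(pauli_mat k c b *\<^sub>v v) \<bullet>c v = overlap k v c b"
proof -
  have "(pauli_mat k c b *\<^sub>v v) \<bullet>c v =
      (\<Sum>i<2 ^ k. walsh k b (c XOR i) * v $ (c XOR i) * cnj (v $ i))"
    using assms
    by (auto simp: scalar_prod_def pauli_mat_mult_vec atLeast0LessThan intro!: sum.cong)
  also have "\<dots> = (\<Sum>i<2 ^ k. walsh k b i * v $ i * cnj (v $ (c XOR i)))"
    using sum_xor_reindex[OF assms(2), of "\<lambda>i. walsh k b i * v $ i * cnj (v $ (c XOR i))"]
    by simp
  finally show ?thesis
    by (simp add: overlap_def mult.assoc)
qed

lemma unit_vector_iff_sum: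
  assumes "v \<in> carrier_vec d"
  shows "unit_vector d v \<longleftrightarrow> (\<Sum>i<d. (cmod (v $ i))\<^sup>2) = 1"
proof -
  have "v \<bullet>c v = complex_of_real (\<Sum>i<d. (cmod (v $ i))\<^sup>2)"
    using assms
    by (auto simp: scalar_prod_def atLeast0LessThan complex_norm_square simp del: of_real_power
        intro!: sum.cong)
  then have "v \<bullet>c v = 1 \<longleftrightarrow> (\<Sum>i<d. (cmod (v $ i))\<^sup>2) = 1"
    by (metis of_real_eq_1_iff)
  then show ?thesis
    using assms by (simp add: unit_vector_def)
qed

lemma unit_vector_pauli_mat:
  assumes "unit_vector (2 ^ k) v" "c < 2 ^ k"
  shows "unit_vector (2 ^ k) (pauli_mat k c b *\<^sub>v v)"
proof -
  have v: "v \<in> carrier_vec (2 ^ k)"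
    using assms(1) by (simp add: unit_vector_def)
  have "(\<Sum>i<2 ^ k. (cmod ((pauli_mat k c b *\<^sub>v v) $ i))\<^sup>2) = (\<Sum>i<2 ^ k. (cmod (v $ (c XOR i)))\<^sup>2)"
    using v assms(2) by (auto simp: pauli_mat_mult_vec norm_mult intro!: sum.cong)
  also have "\<dots> = 1"
    using sum_xor_reindex[OF assms(2), of "\<lambda>i. (cmod (v $ i))\<^sup>2"] assms(1) unit_vector_iff_sum[OF v]
    by simp
  finally show ?thesis
    using unit_vector_iff_sum[of "pauli_mat k c b *\<^sub>v v" "2 ^ k"]
      mult_mat_vec_carrier[OF pauli_mat_carrier v] by simp
qed

text \<open>Substituting \<open>c XOR j\<close> for \<open>j\<close> exchanges the two coordinates
  of \<open>v\<close> and costs the sign \<open>walsh k b c\<close>, which tells whether the matrix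
  is symmetric or skew. Hence each overlap is real or purely imaginary.\<close>

lemma overlap_cnj:
  assumes "c < 2 ^ k"
  shows "overlap k v c b = walsh k b c * cnj (overlap k v c b)"
proof -
  have "overlap k v c b = (\<Sum>j<2 ^ k. walsh k b (c XOR j) * (v $ (c XOR j) * cnj (v $ j)))"
    using sum_xor_reindex[OF assms, of "\<lambda>j. walsh k b j * (v $ j * cnj (v $ (c XOR j)))"]
    by (simp add: overlap_def)
  also have "\<dots> = walsh k b c * cnj (overlap k v c b)"
    by (simp add: overlap_def walsh_xor_right sum_distrib_left mult_ac)
  finally show ?thesis .
qed

lemma overlap_inversion:
  assumes "x < 2 ^ k"
  shows "(\<Sum>b<2 ^ k. walsh k b x * overlap k v c b) = 2 ^ k * (v $ x * cnj (v $ (c XOR x)))"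
proof -
  let ?u = "\<lambda>j. v $ j * cnj (v $ (c XOR j))"
  have "(\<Sum>b<2 ^ k. walsh k b x * overlap k v c b) =
      (\<Sum>b<2 ^ k. \<Sum>j<2 ^ k. walsh k b x * walsh k b j * ?u j)"
    by (simp add: overlap_def sum_distrib_left mult.assoc)
  also have "\<dots> = (\<Sum>j<2 ^ k. (\<Sum>b<2 ^ k. walsh k b x * walsh k b j) * ?u j)"
    by (subst sum.swap) (simp add: sum_distrib_right)
  also have "\<dots> = (\<Sum>j<2 ^ k. if x = j then 2 ^ k * ?u j else 0)"
    using assms by (intro sum.cong) (auto simp: walsh_orthogonal)
  finally show ?thesis
    using assms by simp
qed

text \<open>One factor of each squared modulus is expanded and the sums are swapped. As the Walsh
  signs are real, the inner sum is the conjugate of an inverse transform.\<close>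

lemma overlap_parseval:
  "(\<Sum>b<2 ^ k. (cmod (overlap k v c b))\<^sup>2) =
     2 ^ k * (\<Sum>j<2 ^ k. (cmod (v $ j))\<^sup>2 * (cmod (v $ (c XOR j)))\<^sup>2)"
proof -
  let ?u = "\<lambda>j. v $ j * cnj (v $ (c XOR j))"
  have "complex_of_real (\<Sum>b<2 ^ k. (cmod (overlap k v c b))\<^sup>2) =
      (\<Sum>b<2 ^ k. (\<Sum>j<2 ^ k. walsh k b j * ?u j) * cnj (overlap k v c b))"
    by (simp add: complex_norm_square overlap_def[symmetric] del: of_real_power)
  also have "\<dots> = (\<Sum>j<2 ^ k. \<Sum>b<2 ^ k. walsh k b j * ?u j * cnj (overlap k v c b))"
    by (subst sum.swap) (simp add: sum_distrib_right)
  also have "\<dots> = (\<Sum>j<2 ^ k. ?u j * cnj (\<Sum>b<2 ^ k. walsh k b j * overlap k v c b))"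
    by (simp add: sum_distrib_left mult_ac)
  also have "\<dots> = (\<Sum>j<2 ^ k. 2 ^ k * (?u j * cnj (?u j)))"
    by (intro sum.cong) (auto simp: overlap_inversion)
  also have "\<dots> = complex_of_real (\<Sum>j<2 ^ k. 2 ^ k * (cmod (?u j))\<^sup>2)"
    by (simp only: of_real_sum of_real_power_mult_norm_sq)
  finally show ?thesis
    by (simp only: of_real_eq_iff) (simp add: sum_distrib_left norm_mult power_mult_distrib)
qed

text \<open>For fixed \<open>j\<close>, the index \<open>c XOR j\<close> runs over all coordinates
  as \<open>c\<close> does, so the double sum factors into the square of the squared norm of
  \<open>v\<close>.\<close>

lemma overlap_parseval_unit_vector:
  assumes "unit_vector (2 ^ k) v"
  shows "(\<Sum>c<2 ^ k. \<Sum>b<2 ^ k. (cmod (overlap k v c b))\<^sup>2) = 2 ^ k"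
proof -
  have one: "(\<Sum>i<2 ^ k. (cmod (v $ i))\<^sup>2) = 1"
    using assms unit_vector_iff_sum by (auto simp: unit_vector_def)
  have "(\<Sum>c<2 ^ k. \<Sum>b<2 ^ k. (cmod (overlap k v c b))\<^sup>2) =
      2 ^ k * (\<Sum>j<2 ^ k. (cmod (v $ j))\<^sup>2 * (\<Sum>c<2 ^ k. (cmod (v $ (c XOR j)))\<^sup>2))"
    unfolding overlap_parseval sum_distrib_left[symmetric]
    by (subst sum.swap) (simp add: sum_distrib_left)
  also have "\<dots> = 2 ^ k * (\<Sum>j<2 ^ k. (cmod (v $ j))\<^sup>2 * 1)"
  proof -
    have "(\<Sum>c<2 ^ k. (cmod (v $ (c XOR j)))\<^sup>2) = 1" if "j < 2 ^ k" for j
      using sum_xor_reindex[OF that, of "\<lambda>i. (cmod (v $ i))\<^sup>2"] one by (simp add: xor.commute)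
    then show ?thesis
      by simp
  qed
  finally show ?thesis
    using one by simp
qed

lemma overlap_0_0:
  assumes "unit_vector (2 ^ k) v"
  shows "overlap k v 0 0 = 1"
  using pauli_mat_inner[of v k 0 0] assms by (simp add: unit_vector_def pauli_mat_0_0)

section \<open>The common angle\<close>

lemma norm_overlap_equiangular:
  assumes unit: "unit_vector (2 ^ k) v"
    and card: "card ((\<lambda>A. line_of (2 ^ k) (A *\<^sub>v v)) ` pauli_tensors k) = (2 ^ k)\<^sup>2"
    and equi: "equiangular_lines (2 ^ k) ((\<lambda>A. line_of (2 ^ k) (A *\<^sub>v v)) ` pauli_tensors k)"
  obtains a where
    "\<And>c b. c < 2 ^ k \<Longrightarrow> b < 2 ^ k \<Longrightarrow> (c, b) \<noteq> (0, 0) \<Longrightarrow> cmod (overlap k v c b) = a"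
proof -
  let ?l = "\<lambda>A. line_of (2 ^ k) (A *\<^sub>v v)"
  have v: "v \<in> carrier_vec (2 ^ k)"
    using unit by (simp add: unit_vector_def)
  have "card (?l ` pauli_tensors k) = card (pauli_tensors k)"
    using pauli_tensors_finite_card[of k] card card_image_le[of "pauli_tensors k" ?l] by simp
  then have inj: "inj_on ?l (pauli_tensors k)"
    using pauli_tensors_finite_card(1) eq_card_imp_inj_on by blast
  let ?L = "?l ` pauli_tensors k"
  have "\<exists>a::real. \<forall>z w. unit_vector (2 ^ k) z \<and> unit_vector (2 ^ k) w \<and>
      line_of (2 ^ k) z \<in> ?L \<and> line_of (2 ^ k) w \<in> ?L \<and> line_of (2 ^ k) z \<noteq> line_of (2 ^ k) w \<longrightarrow>
      cmod (z \<bullet>c w) = a"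
    using equi unfolding equiangular_lines_def by (rule conjunct2)
  then obtain a where "\<forall>z w. unit_vector (2 ^ k) z \<and> unit_vector (2 ^ k) w \<and>
      line_of (2 ^ k) z \<in> ?L \<and> line_of (2 ^ k) w \<in> ?L \<and> line_of (2 ^ k) z \<noteq> line_of (2 ^ k) w \<longrightarrow>
      cmod (z \<bullet>c w) = a"
    by (rule exE)
  then have a: "cmod (z \<bullet>c w) = a"
    if "unit_vector (2 ^ k) z" "unit_vector (2 ^ k) w" "line_of (2 ^ k) z \<in> ?L"
      "line_of (2 ^ k) w \<in> ?L" "line_of (2 ^ k) z \<noteq> line_of (2 ^ k) w" for z w
    using that by simp
  have mem: "1\<^sub>m (2 ^ k) \<in> pauli_tensors k"
    using pauli_mat_mem[of 0 k 0] by (simp add: pauli_mat_0_0)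
  have v_mem: "line_of (2 ^ k) v \<in> ?L"
    using imageI[OF mem, of ?l] v by simp
  show thesis
  proof (rule that[of a])
    fix c b :: nat assume cb: "c < 2 ^ k" "b < 2 ^ k" "(c, b) \<noteq> (0, 0)"
    then have "pauli_mat k c b \<noteq> 1\<^sub>m (2 ^ k)"
      by (simp add: pauli_mat_eq_one_iff)
    \<comment> \<open>Only pairs of distinct lines are constrained by equiangularity, so injectivity
      is needed before comparing with the line of \<open>v\<close>.\<close>
    then have "?l (pauli_mat k c b) \<noteq> ?l (1\<^sub>m (2 ^ k))"
      using inj_onD[OF inj _ pauli_mat_mem[OF cb(1,2)] mem] by blast
    then have "cmod ((pauli_mat k c b *\<^sub>v v) \<bullet>c v) = a"
      using a[OF unit_vector_pauli_mat[OF unit cb(1)] unit _ v_mem] pauli_mat_mem[OF cb(1,2)] v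
      by auto
    then show "cmod (overlap k v c b) = a"
      using pauli_mat_inner[OF v cb(1)] by simp
  qed
qed

text \<open>Splitting off the overlap 1 at \<open>(0, 0)\<close>, Parseval reads
  \<open>d = 1 + (d\<^sup>2 - 1) a\<^sup>2\<close>; the factor \<open>d - 1\<close> cancels since
  \<open>k \<ge> 1\<close>.\<close>

lemma norm_overlap_sq:
  assumes unit: "unit_vector (2 ^ k) v" and "k \<ge> 1"
    and a: "\<And>c b. c < 2 ^ k \<Longrightarrow> b < 2 ^ k \<Longrightarrow> (c, b) \<noteq> (0, 0) \<Longrightarrow> cmod (overlap k v c b) = a"
  shows "a\<^sup>2 * (2 ^ k + 1) = 1"
proof -
  let ?d = "2 ^ k :: real"
  let ?S = "{..<2 ^ k :: nat} \<times> {..<2 ^ k :: nat}"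
  have "?d = (\<Sum>(c, b)\<in>?S. (cmod (overlap k v c b))\<^sup>2)"
    using overlap_parseval_unit_vector[OF unit] by (simp add: sum.cartesian_product)
  also have "\<dots> = 1 + (\<Sum>(c, b)\<in>?S - {(0, 0)}. (cmod (overlap k v c b))\<^sup>2)"
    by (subst sum.remove[of _ "(0, 0)"]) (auto simp: overlap_0_0[OF unit])
  also have "(\<Sum>(c, b)\<in>?S - {(0, 0)}. (cmod (overlap k v c b))\<^sup>2) = (\<Sum>_\<in>?S - {(0, 0)}. a\<^sup>2)"
  proof (rule sum.cong)
    fix p assume "p \<in> ?S - {(0, 0)}"
    then show "(case p of (c, b) \<Rightarrow> (cmod (overlap k v c b))\<^sup>2) = a\<^sup>2"
      using a[of "fst p" "snd p"] by (auto simp: split_beta prod_eq_iff)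
  qed simp
  also have "\<dots> = (?d\<^sup>2 - 1) * a\<^sup>2"
    by (simp add: card_Diff_subset of_nat_diff power2_eq_square)
  finally have "(?d - 1) * (a\<^sup>2 * (?d + 1) - 1) = 0"
    by (simp add: algebra_simps power2_eq_square)
  moreover have "?d > 1"
    using \<open>k \<ge> 1\<close> by (intro one_less_power) auto
  ultimately show ?thesis
    by simp
qed

section \<open>Arithmetic: Gaussian units, irrational roots, squares of the form
  \<open>2 ^ k + 1\<close>\<close>

lemma gaussian_unit_cases:
  assumes "cmod z = 1" "z = cnj z \<or> z = - cnj z"
  shows "z \<in> {1, -1, \<i>, -\<i>}"
proof -
  have "(Re z)\<^sup>2 + (Im z)\<^sup>2 = 1"
    using assms(1) by (metis cmod_power2 one_power2)
  moreover have "Im z = 0 \<or> Re z = 0"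
    using assms(2) by (auto simp: complex_eq_iff)
  ultimately show ?thesis
    by (auto simp: complex_eq_iff power2_eq_1_iff)
qed

text \<open>A nonzero \<open>q\<close> would satisfy \<open>p\<^sup>2 = q\<^sup>2 n\<close>, hence
  divide \<open>p\<close>, making \<open>n\<close> the square of the quotient.\<close>

lemma rational_root_coeff_zero:
  fixes p q :: int and n :: nat and s :: real
  assumes "of_int p + of_int q * s = 0" "s\<^sup>2 = of_nat n" "\<And>m. n \<noteq> m\<^sup>2"
  shows "q = 0"
proof (rule ccontr)
  assume "q \<noteq> 0"
  have "(of_int p :: real)\<^sup>2 = (of_int q)\<^sup>2 * of_nat n"
    using assms(1,2) by (metis add_eq_0_iff power2_minus power_mult_distrib)
  then have eq: "p\<^sup>2 = q\<^sup>2 * int n"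
    by (metis of_int_eq_iff of_int_mult of_int_of_nat_eq of_int_power)
  then obtain r where "p = q * r"
    by (metis dvd_def pow_divides_pow_iff zero_less_numeral)
  with eq \<open>q \<noteq> 0\<close> have "int n = r\<^sup>2"
    by (simp add: power_mult_distrib)
  then have "n = (nat \<bar>r\<bar>)\<^sup>2"
    by (metis nat_int nat_power_eq abs_ge_zero power2_abs)
  with assms(3) show False
    by blast
qed

text \<open>Here \<open>(m - 1) (m + 1)\<close> is a power of two, so both factors are powers of
  two. They differ by 2, hence are 2 and 4.\<close>

lemma two_power_plus_one_square:
  assumes "2 ^ k + 1 = (m :: nat)\<^sup>2"
  shows "k = 3"
proof -
  have m: "m \<ge> 2"
    using assms by (cases "m = 0 \<or> m = 1") auto
  define n where "n = m - 1"
  have "n * (n + 2) = 2 ^ k"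
    using assms m unfolding n_def by (cases m) (auto simp: power2_eq_square)
  then obtain i j where n: "n = 2 ^ i" and n2: "n + 2 = 2 ^ j"
    by (metis divides_primepow_nat two_is_prime_nat dvd_triv_left dvd_triv_right)
  have "i = 1"
  proof (rule ccontr)
    assume "i \<noteq> 1"
    then consider "i = 0" | i' where "i = i' + 2"
      by (metis One_nat_def add_2_eq_Suc' not0_implies_Suc)
    then show False
    proof cases
      \<comment> \<open>With \<open>i = 0\<close> the larger factor would be 3.\<close>
      case 1
      then show False
        using n n2 by (cases j) (auto, presburger)
    next
      \<comment> \<open>Now \<open>2 ^ i + 2\<close> is 2 modulo 4, whereas \<open>2 ^ j\<close>
        with \<open>j \<ge> 2\<close> is divisible by 4.\<close>
      case 2
      have "j \<ge> 2"
        using n2 n 2 by (cases j; cases "j - 1") auto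
      then obtain j' where "j = j' + 2"
        by (metis le_add_diff_inverse2)
      then show False
        using n2 n 2 by (simp add: power_add) presburger
    qed
  qed
  then have "2 ^ k = (2 :: nat) ^ 3"
    using n \<open>n * (n + 2) = 2 ^ k\<close> by simp
  then show ?thesis
    by (simp only: power_inject_exp)
qed

section \<open>Integrality of rescaled products of coordinates\<close>

lemma normalized_overlap_cases:
  assumes "c < 2 ^ k" "cmod (overlap k v c b) = a" "a * s = 1" "s > 0"
  shows "of_real s * overlap k v c b \<in> {1, -1, \<i>, -\<i>}"
proof (rule gaussian_unit_cases)
  show "cmod (of_real s * overlap k v c b) = 1"
    using assms by (simp add: norm_mult mult.commute)
  show "of_real s * overlap k v c b = cnj (of_real s * overlap k v c b) \<or>
      of_real s * overlap k v c b = - cnj (of_real s * overlap k v c b)"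
    using overlap_cnj[OF assms(1), of v b] walsh_cases[of k b c]
    by (metis complex_cnj_complex_of_real complex_cnj_mult mult_1 mult_minus_left mult_minus_right)
qed

lemma walsh_mult_gaussian_unit_Ints:
  assumes "z \<in> {1, -1, \<i>, -\<i>}"
  shows "Re (walsh k b x * z) \<in> \<int>" "Im (walsh k b x * z) \<in> \<int>"
  using assms walsh_cases[of k b x] by auto

lemma normalized_offdiagonal_sq_Ints:
  assumes xy: "x < 2 ^ k" "y < 2 ^ k" "x \<noteq> y"
    and g: "\<And>c b. c < 2 ^ k \<Longrightarrow> b < 2 ^ k \<Longrightarrow> (c, b) \<noteq> (0, 0) \<Longrightarrow>
      of_real s * overlap k v c b \<in> {1, -1, \<i>, -\<i>}"
  shows "(s * 2 ^ k * cmod (v $ x) * cmod (v $ y))\<^sup>2 \<in> \<int>"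
proof -
  \<comment> \<open>This translation pairs coordinate \<open>x\<close> with \<open>y\<close>, so
    inversion at \<open>x\<close> recovers their product. As \<open>c \<noteq> 0\<close>, every term
    is a Gaussian unit and \<open>z\<close> is a Gaussian integer.\<close>
  define c where "c = x XOR y"
  have c: "c < 2 ^ k" "c \<noteq> 0"
    using xy by (auto simp: c_def xor_less_power xor_eq_zero_iff)
  define z where "z = (\<Sum>b<2 ^ k. walsh k b x * (of_real s * overlap k v c b))"
  have unit: "Re (walsh k b x * (of_real s * overlap k v c b)) \<in> \<int> \<and>
      Im (walsh k b x * (of_real s * overlap k v c b)) \<in> \<int>" if "b < 2 ^ k" for b
    using walsh_mult_gaussian_unit_Ints[OF g[OF c(1) that]] c(2) by simp
  have "Re z \<in> \<int>" "Im z \<in> \<int>"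
    unfolding z_def Re_sum Im_sum using unit by (blast intro: Ints_sum)+
  then have "(cmod z)\<^sup>2 \<in> \<int>"
    by (simp add: cmod_power2)
  moreover have "z = of_real s * (2 ^ k * (v $ x * cnj (v $ (c XOR x))))"
    unfolding z_def overlap_inversion[OF xy(1), symmetric] by (simp add: sum_distrib_left mult_ac)
  moreover have "c XOR x = y"
    by (metis c_def xor.commute xor_cancel_left)
  ultimately show ?thesis
    by (simp add: norm_mult norm_power power_mult_distrib mult_ac)
qed

lemma normalized_diagonal_Ints:
  assumes unit: "unit_vector (2 ^ k) v" and x: "x < 2 ^ k"
    and g: "\<And>b. b < 2 ^ k \<Longrightarrow> b \<noteq> 0 \<Longrightarrow> of_real s * overlap k v 0 b \<in> {1, -1, \<i>, -\<i>}"
  shows "s * (2 ^ k * (cmod (v $ x))\<^sup>2 - 1) \<in> \<int>"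
proof -
  define t where "t = 2 ^ k * (cmod (v $ x))\<^sup>2"
  have "of_real t = (2 ^ k * (v $ x * cnj (v $ x)) :: complex)"
    unfolding t_def by (rule of_real_power_mult_norm_sq)
  also have "\<dots> = (\<Sum>b<2 ^ k. walsh k b x * overlap k v 0 b)"
    using overlap_inversion[OF x, of v 0] by simp
  \<comment> \<open>The overlap at \<open>b = 0\<close> is 1 and is not covered by \<open>g\<close>;
    removing it accounts for the \<open>- 1\<close> in the conclusion.\<close>
  also have "\<dots> = 1 + (\<Sum>b\<in>{..<2 ^ k} - {0}. walsh k b x * overlap k v 0 b)"
    by (subst sum.remove[of _ 0]) (auto simp: overlap_0_0[OF unit])
  finally have "of_real s * (of_real t - 1) =
      (\<Sum>b\<in>{..<2 ^ k} - {0}. walsh k b x * (of_real s * overlap k v 0 b))"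
    by (simp add: sum_distrib_left mult_ac)
  then have "Re (of_real s * (of_real t - 1)) =
      (\<Sum>b\<in>{..<2 ^ k} - {0}. Re (walsh k b x * (of_real s * overlap k v 0 b)))"
    by (simp only: Re_sum)
  moreover have "Re (walsh k b x * (of_real s * overlap k v 0 b)) \<in> \<int>"
    if "b \<in> {..<2 ^ k} - {0}" for b
    using walsh_mult_gaussian_unit_Ints(1)[OF g] that by simp
  ultimately have "Re (of_real s * (of_real t - 1)) \<in> \<int>"
    by (metis (no_types, lifting) Ints_sum)
  then show ?thesis
    by (simp add: t_def)
qed

text \<open>The Walsh transform of a constant function vanishes away from 0. This supplies the final
  contradiction.\<close>

lemma overlap_flat_vector:
  assumes flat: "\<And>x. x < 2 ^ k \<Longrightarrow> (cmod (v $ x))\<^sup>2 = r" and b: "b < 2 ^ k" "b \<noteq> 0"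
  shows "overlap k v 0 b = 0"
proof -
  have "overlap k v 0 b = (\<Sum>j<2 ^ k. walsh k j b * of_real r)"
    unfolding overlap_def
    by (intro sum.cong) (auto simp: walsh_commute[of k b] complex_norm_square simp flip: flat
        simp del: of_real_power)
  also have "\<dots> = (\<Sum>j<2 ^ k. walsh k j b) * of_real r"
    by (simp add: sum_distrib_right)
  finally show ?thesis
    using sum_walsh[OF b(1)] b(2) by simp
qed

section \<open>Conclusion: irrationality of \<open>s\<close> forces a flat vector\<close>

theorem lemma3p1:
  fixes k d :: nat and v :: "complex vec"
  assumes "k \<ge> 1"
    and "d = 2 ^ k"
    and "unit_vector d v"
    and "card ((\<lambda>A. line_of d (A *\<^sub>v v)) ` pauli_tensors k) = d\<^sup>2"
    and "equiangular_lines d ((\<lambda>A. line_of d (A *\<^sub>v v)) ` pauli_tensors k)"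
  shows "k = 1 \<or> k = 3"
proof (rule ccontr)
  assume k: "\<not> (k = 1 \<or> k = 3)"
  have unit: "unit_vector (2 ^ k) v"
    using assms by simp
  obtain a where a: "\<And>c b. c < 2 ^ k \<Longrightarrow> b < 2 ^ k \<Longrightarrow> (c, b) \<noteq> (0, 0) \<Longrightarrow>
      cmod (overlap k v c b) = a"
    using norm_overlap_equiangular[of k v] assms(3-5) unfolding assms(2) by blast
  define s where "s = sqrt (2 ^ k + 1)"
  have s: "s > 0" "s\<^sup>2 = 2 ^ k + 1"
    by (simp_all add: s_def add_pos_pos)
  have "(1 :: nat) < 2 ^ k"
    using \<open>k \<ge> 1\<close> by (intro one_less_power) auto
  \<comment> \<open>Realising \<open>a\<close> as a modulus gives its sign, which selects the root 1
    of \<open>(a * s)\<^sup>2 = 1\<close>.\<close>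
  then have "cmod (overlap k v 0 1) = a"
    using a[of 0 1] by simp
  then have "a * s \<ge> 0"
    using s(1) by (metis less_imp_le mult_nonneg_nonneg norm_ge_zero)
  moreover have "(a * s)\<^sup>2 = 1"
    using norm_overlap_sq[OF unit \<open>k \<ge> 1\<close> a] s by (simp add: power_mult_distrib)
  ultimately have as: "a * s = 1"
    by (auto simp: power2_eq_1_iff)
  have g: "of_real s * overlap k v c b \<in> {1, -1, \<i>, -\<i>}"
    if "c < 2 ^ k" "b < 2 ^ k" "(c, b) \<noteq> (0, 0)" for c b
    using normalized_overlap_cases[OF that(1) a[OF that] as s(1)] .
  \<comment> \<open>This is the integer \<open>n\<^sub>x\<close> of the overview, chosen so that
    \<open>s * 2 ^ k * (cmod (v $ x))\<^sup>2 = s + h x\<close>.\<close>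
  define h where "h x = s * (2 ^ k * (cmod (v $ x))\<^sup>2 - 1)" for x
  have h_Ints: "h x \<in> \<int>" if "x < 2 ^ k" for x
    unfolding h_def using normalized_diagonal_Ints[OF unit that] g by auto
  have opposite: "h x + h y = 0" if xy: "x < 2 ^ k" "y < 2 ^ k" "x \<noteq> y" for x y
  proof -
    have "(s * 2 ^ k * cmod (v $ x) * cmod (v $ y))\<^sup>2 = (s + h x) * (s + h y)"
      by (simp add: h_def algebra_simps power2_eq_square)
    then have "(s + h x) * (s + h y) \<in> \<int>"
      using normalized_offdiagonal_sq_Ints[OF xy g] by simp
    moreover have "(s + h x) * (s + h y) = 2 ^ k + 1 + h x * h y + (h x + h y) * s"
      unfolding s(2)[symmetric] by (simp add: algebra_simps power2_eq_square)
    moreover obtain m n where mn: "h x = of_int m" "h y = of_int n"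
      using h_Ints xy by (meson Ints_cases)
    \<comment> \<open>An integer relation between 1 and \<open>s\<close>: since
      \<open>2 ^ k + 1\<close> is not a square, the coefficient \<open>m + n\<close> of
      \<open>s\<close> must vanish.\<close>
    ultimately obtain N where "of_int N = 2 ^ k + 1 + of_int (m * n) + of_int (m + n) * s"
      by (metis Ints_cases of_int_add of_int_mult)
    then have "of_int (2 ^ k + 1 + m * n - N) + of_int (m + n) * s = 0"
      by simp
    moreover have "s\<^sup>2 = of_nat (2 ^ k + 1)"
      using s(2) by simp
    moreover have "2 ^ k + 1 \<noteq> m\<^sup>2" for m :: nat
      using two_power_plus_one_square k by blast
    ultimately have "m + n = 0"
      by (rule rational_root_coeff_zero)
    then show ?thesis
      unfolding mn by (metis of_int_0 of_int_add)
  qed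
  \<comment> \<open>Excluding \<open>k = 1\<close> provides three distinct indices; pairwise
    opposite values at 0, 1 and 2 must all be zero.\<close>
  have "(2 :: nat) ^ 2 \<le> 2 ^ k"
    using k \<open>k \<ge> 1\<close> by (intro power_increasing) auto
  then have "0 < (2 :: nat) ^ k" "1 < (2 :: nat) ^ k" "2 < (2 :: nat) ^ k"
    by simp_all
  then have "h 0 = 0"
    using opposite[of 0 1] opposite[of 0 2] opposite[of 1 2] by simp
  have "h x = 0" if "x < 2 ^ k" for x
    using opposite[of 0 x] that \<open>h 0 = 0\<close> by (cases "x = 0") auto
  then have "(cmod (v $ x))\<^sup>2 = 1 / 2 ^ k" if "x < 2 ^ k" for x
    using that s(1) by (simp add: h_def field_simps)
  then have "overlap k v 0 1 = 0"
    using \<open>1 < 2 ^ k\<close> by (intro overlap_flat_vector) auto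
  then show False
    using g[of 0 1] \<open>1 < 2 ^ k\<close> by simp
qed

end
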